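(* For every $r\ge0$, $\tau(P_r)\le\frac52 q_r$, where $q_r=4^{2^r}$. Consequently, $$\frac{\tau(P_r)}{\nu(P_r)}\le\frac52\qquad\text{and}\qquad\frac{\alpha^*(P_r)}{\nu(P_r)}\le\frac52 .$$
   Context: All rectangles are closed and axis-parallel. For a finite rectangle family $\mathcal R$, $\nu(\mathcal R)$ is the maximum size of a pairwise disjoint subfamily, $\tau(\mathcal R)$ is the minimum number of points of the plane such that every rectangle of $\mathcal R$ contains at least one of them, and $G(\mathcal R)$ is the intersection graph (vertices are the rectangles, edges join intersecting pairs). The clique relaxation value is $$\alpha^*(\mathcal R)=\alpha^*(G(\mathcal R))=\max\Big\{\sum_{v}x_v:\ x_v\ge 0,\ \sum_{v\in K}x_v\le 1\text{ for every clique }K\text{ of }G(\mathcal R)\Big\}.$$ Construction of $P_r$. Write $[q]=\{0,1,\dots,q-1\}$. Each $P_r$ is a finite rectangle family drawn in a square $[0,L]^2$ together with $q=q_r$ vertical marker lines $x=\xi_0,\dots,x=\xi_{q-1}$ and $q$ horizontal marker lines $y=\eta_0,\dots,y=\eta_{q-1}$ (in increasing order). Base: $P_0$ has $L=30$, $q=4$, $\xi=(3,11,19,27)$, $\eta=(3,11,21,27)$ and consists of the eight rectangles $T=[0,30]\times[26,28]$, $U_L=[0,16]\times[20,22]$, $U_R=[14,30]\times[20,22]$, $C_0=[0,8]\times[2,10]$, $C_1=[6,16]\times[8,14]$, $C_2=[14,24]\times[8,14]$, $C_3=[22,30]\times[2,12]$, $Q=[6,24]\times[0,4]$. Crossbar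 step: given $P$ with data $L,q,\xi,\eta$, put $M=L+1$, and for $R=[x_1,x_2]\times[y_1,y_2]\in P$ and $i,j\in[q]$ let $$H_i(R)=[Mx_1,Mx_2]\times[M\xi_i+y_1,M\xi_i+y_2],\qquad V_j(R)=[M\xi_j+y_1,M\xi_j+y_2]\times[Mx_1,Mx_2].$$ $C(P)$ is the family of all $H_i(R)$ and $V_j(R)$ with $R\in P$, $i,j\in[q]$. It is drawn in $[0,ML+L]^2$, with $q^2$ vertical markers $\xi'_{(j,t)}=M\xi_j+\eta_t$ and $q^2$ horizontal markers $\eta'_{(i,t)}=M\xi_i+\eta_t$, indexed by $[q]\times[q]$ and ordered lexicographically. Recursion: $P_{r+1}=C(P_r)$ for $r\ge0$; thus $q_0=4$ and $q_{r+1}=q_r^2$. *)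

theory Defs
  imports "HOL-Analysis.Analysis" "HOL-Library.Ramsey"
begin

section \<open>Rectangle families and their parameters\<close>

text \<open>\<open>Rect x\<^sub>1 x\<^sub>2 y\<^sub>1 y\<^sub>2\<close> stands for \<open>[x\<^sub>1, x\<^sub>2] \<times> [y\<^sub>1, y\<^sub>2]\<close>. All rectangles of the families \<open>P r\<close> are
  nonempty (\<open>P_wf\<close> below), so distinct coordinates mean distinct point sets there.\<close>

datatype rect = Rect real real real real

fun region :: "rect \<Rightarrow> (real \<times> real) set" where
  "region (Rect x1 x2 y1 y2) = {x1..x2} \<times> {y1..y2}"

definition nu :: "rect set \<Rightarrow> nat" where
  "nu F = Max {card S | S. S \<subseteq> F \<and> disjoint_family_on region S}"

definition pierces :: "(real \<times> real) set \<Rightarrow> rect set \<Rightarrow> bool" where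
  "pierces X F \<longleftrightarrow> (\<forall>R\<in>F. X \<inter> region R \<noteq> {})"

definition tau :: "rect set \<Rightarrow> nat" where
  "tau F = (LEAST k. \<exists>X. finite X \<and> card X = k \<and> pierces X F)"

text \<open>A graph is given by its vertex set and its set of two-element edges, in the format of
  \<^const>\<open>clique\<close>, which does not itself confine \<open>K\<close> to the vertex set.\<close>

definition intersection_edges :: "rect set \<Rightarrow> rect set set" where
  "intersection_edges F = {{A, B} | A B. A \<in> F \<and> B \<in> F \<and> A \<noteq> B \<and> region A \<inter> region B \<noteq> {}}"

definition clique_feasible :: "'a set \<Rightarrow> 'a set set \<Rightarrow> ('a \<Rightarrow> real) \<Rightarrow> bool" where
  "clique_feasible V E x \<longleftrightarrow> (\<forall>v\<in>V. 0 \<le> x v) \<and> (\<forall>K. K \<subseteq> V \<and> clique K E \<longrightarrow> (\<Sum>v\<in>K. x v) \<le> 1)"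

text \<open>The supremum is a maximum for finite graphs (\<open>graph_alpha_star_attained\<close> below).\<close>

definition graph_alpha_star :: "'a set \<Rightarrow> 'a set set \<Rightarrow> real" where
  "graph_alpha_star V E = Sup {(\<Sum>v\<in>V. x v) | x. clique_feasible V E x}"

definition alpha_star :: "rect set \<Rightarrow> real" where
  "alpha_star F = graph_alpha_star F (intersection_edges F)"

section \<open>The families \<open>P r\<close>\<close>

text \<open>Only the values \<open>xi i\<close> and \<open>eta i\<close> with \<open>i < markers\<close> are meaningful.\<close>

record drawing =
  rects :: "rect set"
  side :: real
  markers :: nat
  xi :: "nat \<Rightarrow> real"
  eta :: "nat \<Rightarrow> real"

definition base_drawing :: drawing where
  "base_drawing = \<lparr>
     rects =
       {Rect 0 30 26 28,
        Rect 0 16 20 22, Rect 14 30 20 22,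
        Rect 0 8 2 10, Rect 6 16 8 14, Rect 14 24 8 14, Rect 22 30 2 12,
        Rect 6 24 0 4},
     side = 30,
     markers = 4,
     xi = (\<lambda>i. [3, 11, 19, 27] ! i),
     eta = (\<lambda>i. [3, 11, 21, 27] ! i)\<rparr>"

fun horizontal_copy :: "real \<Rightarrow> real \<Rightarrow> rect \<Rightarrow> rect" where
  "horizontal_copy M c (Rect x1 x2 y1 y2) = Rect (M * x1) (M * x2) (M * c + y1) (M * c + y2)"

fun vertical_copy :: "real \<Rightarrow> real \<Rightarrow> rect \<Rightarrow> rect" where
  "vertical_copy M c (Rect x1 x2 y1 y2) = Rect (M * c + y1) (M * c + y2) (M * x1) (M * x2)"

text \<open>The new markers are indexed by pairs \<open>(j, t)\<close> in lexicographic order; the pair \<open>(j, t)\<close> is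
  encoded as \<open>k = j * q + t\<close>, so that \<open>j = k div q\<close> and \<open>t = k mod q\<close>. Both marker
  directions use the same formula.\<close>

definition crossbar :: "drawing \<Rightarrow> drawing" where
  "crossbar D =
    (let M = side D + 1; q = markers D;
         marker = (\<lambda>k. M * xi D (k div q) + eta D (k mod q))
     in \<lparr>rects = {horizontal_copy M (xi D i) R | i R. i < q \<and> R \<in> rects D} \<union>
                 {vertical_copy M (xi D j) R | j R. j < q \<and> R \<in> rects D},
         side = M * side D + side D,
         markers = q\<^sup>2,
         xi = marker,
         eta = marker\<rparr>)"

fun P :: "nat \<Rightarrow> drawing" where
  "P 0 = base_drawing"
| "P (Suc r) = crossbar (P r)"

section \<open>The parameters are well defined\<close>

lemma nu_set:
  assumes "finite F"
  shows "finite {card S | S. S \<subseteq> F \<and> disjoint_family_on region S}"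
    and "{card S | S. S \<subseteq> F \<and> disjoint_family_on region S} \<noteq> {}"
proof -
  have "{card S | S. S \<subseteq> F \<and> disjoint_family_on region S} \<subseteq> card ` Pow F" by auto
  then show "finite {card S | S. S \<subseteq> F \<and> disjoint_family_on region S}"
    using assms by (meson finite_Pow_iff finite_imageI finite_subset)
  have "disjoint_family_on region {}" by (simp add: disjoint_family_on_def)
  then show "{card S | S. S \<subseteq> F \<and> disjoint_family_on region S} \<noteq> {}" by blast
qed

lemma nu_attained:
  assumes "finite F"
  shows "\<exists>S\<subseteq>F. disjoint_family_on region S \<and> card S = nu F"
  using Max_in[OF nu_set[OF assms]] unfolding nu_def by (smt (verit) mem_Collect_eq)

lemma card_le_nu:
  assumes "finite F" "S \<subseteq> F" "disjoint_family_on region S"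
  shows "card S \<le> nu F"
  unfolding nu_def by (rule Max_ge[OF nu_set(1)[OF assms(1)]]) (use assms in blast)

lemma tau_attained:
  assumes "finite F" "\<And>R. R \<in> F \<Longrightarrow> region R \<noteq> {}"
  shows "\<exists>X. finite X \<and> card X = tau F \<and> pierces X F"
proof -
  let ?X = "(\<lambda>R. SOME p. p \<in> region R) ` F"
  have "pierces ?X F"
    unfolding pierces_def using assms(2) by (metis IntI empty_iff image_eqI some_in_eq)
  then have "\<exists>X. finite X \<and> card X = card ?X \<and> pierces X F" using assms(1) by blast
  then show ?thesis unfolding tau_def by (rule LeastI)
qed

lemma tau_le_card:
  assumes "finite X" "pierces X F"
  shows "tau F \<le> card X"
  unfolding tau_def by (rule Least_le) (use assms in blast)

lemma graph_alpha_star_attained: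
  fixes V :: "'a set"
  assumes V: "finite V"
  shows "\<exists>x. clique_feasible V E x \<and> (\<Sum>v\<in>V. x v) = graph_alpha_star V E \<and>
             (\<forall>y. clique_feasible V E y \<longrightarrow> (\<Sum>v\<in>V. y v) \<le> (\<Sum>v\<in>V. x v))"
proof -
  define B :: "('a \<Rightarrow> real) set" where "B = PiE UNIV (\<lambda>v. if v \<in> V then {0..1} else {0})"
  define C :: "('a \<Rightarrow> real) set" where
    "C = (\<Inter>K\<in>{K. K \<subseteq> V \<and> clique K E}. {x. (\<Sum>v\<in>K. x v) \<le> 1})"
  have feas: "clique_feasible V E x" if "x \<in> B \<inter> C" for x
    unfolding clique_feasible_def
  proof (intro conjI ballI allI impI)
    fix v assume "v \<in> V"
    have "x v \<in> (if v \<in> V then {0..1} else {0})" using that unfolding B_def by blast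
    with \<open>v \<in> V\<close> show "0 \<le> x v" by simp
  qed (use that in \<open>auto simp: C_def\<close>)
  have trunc: "(\<lambda>v. if v \<in> V then y v else 0) \<in> B \<inter> C" if y: "clique_feasible V E y" for y
  proof -
    have "y v \<le> 1" if "v \<in> V" for v
    proof -
      have "clique {v} E" by (simp add: clique_def)
      then have "(\<Sum>w\<in>{v}. y w) \<le> 1" using y that unfolding clique_feasible_def by blast
      then show ?thesis by simp
    qed
    moreover have "(\<Sum>v\<in>K. if v \<in> V then y v else 0) = (\<Sum>v\<in>K. y v)" if "K \<subseteq> V" for K
      using that by (intro sum.cong) auto
    ultimately show ?thesis using y unfolding B_def C_def clique_feasible_def by auto
  qed
  have "compactin (product_topology (\<lambda>_::'a. euclidean) UNIV)
          (PiE UNIV (\<lambda>v. if v \<in> V then {0..1::real} else {0}))"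
    unfolding compactin_PiE by (auto simp: compactin_euclidean_iff)
  then have "compact B"
    unfolding euclidean_product_topology B_def by (simp only: compactin_euclidean_iff)
  moreover have "closed C"
    unfolding C_def
  proof (intro closed_INT ballI)
    fix K :: "'a set"
    show "closed {x::'a \<Rightarrow> real. (\<Sum>v\<in>K. x v) \<le> 1}"
      by (intro closed_Collect_le continuous_on_sum continuous_on_const) auto
  qed
  ultimately have comp: "compact (B \<inter> C)" by (rule compact_Int_closed)
  have "clique_feasible V E (\<lambda>_. 0)" by (simp add: clique_feasible_def)
  then have ne: "B \<inter> C \<noteq> {}" using trunc by blast
  have "continuous_on (B \<inter> C) (\<lambda>x. \<Sum>v\<in>V. x v)"
    by (intro continuous_on_sum) (rule continuous_on_subset[OF continuous_on_product_coordinates subset_UNIV])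
  from continuous_attains_sup[OF comp ne this] obtain x
    where x: "x \<in> B \<inter> C" and max: "\<forall>y\<in>B \<inter> C. (\<Sum>v\<in>V. y v) \<le> (\<Sum>v\<in>V. x v)" by blast
  have max': "(\<Sum>v\<in>V. y v) \<le> (\<Sum>v\<in>V. x v)" if "clique_feasible V E y" for y
  proof -
    have "(\<Sum>v\<in>V. y v) = (\<Sum>v\<in>V. if v \<in> V then y v else 0)" by (intro sum.cong) auto
    also have "\<dots> \<le> (\<Sum>v\<in>V. x v)" using max trunc[OF that] by blast
    finally show ?thesis .
  qed
  have "graph_alpha_star V E = (\<Sum>v\<in>V. x v)"
    unfolding graph_alpha_star_def using feas[OF x] max' by (intro cSup_eq_maximum) blast+
  then show ?thesis using feas[OF x] max' by metis
qed

lemma P_wf: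
  shows "finite (rects (P r))" and "rects (P r) \<noteq> {}"
    and "R \<in> rects (P r) \<Longrightarrow> region R \<noteq> {}"
    and "0 < side (P r)" and "0 < markers (P r)"
proof -
  have "finite (rects (P r)) \<and> rects (P r) \<noteq> {} \<and> (\<forall>R\<in>rects (P r). region R \<noteq> {}) \<and>
        0 < side (P r) \<and> 0 < markers (P r)"
  proof (induction r)
    case 0
    show ?case by (simp add: base_drawing_def)
  next
    case (Suc r)
    define D where "D = P r"
    define M where "M = side D + 1"
    note IH = Suc.IH[folded D_def]
    have M: "M > 0" using IH by (simp add: M_def)
    have eq: "rects (crossbar D) =
        (\<lambda>(i, R). horizontal_copy M (xi D i) R) ` ({..<markers D} \<times> rects D) \<union>
        (\<lambda>(j, R). vertical_copy M (xi D j) R) ` ({..<markers D} \<times> rects D)"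
      by (auto simp: crossbar_def Let_def M_def image_iff)
    have "region (horizontal_copy M c R) \<noteq> {} \<and> region (vertical_copy M c R) \<noteq> {}"
      if "region R \<noteq> {}" for c R
      using that M by (cases R) auto
    then have "\<forall>R\<in>rects (crossbar D). region R \<noteq> {}" using IH by (auto simp: eq)
    moreover have "finite (rects (crossbar D))" using IH by (simp add: eq)
    moreover have "rects (crossbar D) \<noteq> {}" using IH by (auto simp: eq)
    moreover have "0 < side (crossbar D)" "0 < markers (crossbar D)"
      using IH by (auto simp: crossbar_def Let_def add_pos_pos)
    ultimately show ?case by (simp add: D_def)
  qed
  then show "finite (rects (P r))" "rects (P r) \<noteq> {}"
    "R \<in> rects (P r) \<Longrightarrow> region R \<noteq> {}" "0 < side (P r)" "0 < markers (P r)" by auto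
qed

lemma nu_P_pos: "0 < nu (rects (P r))"
proof -
  obtain R where "R \<in> rects (P r)" using P_wf(2) by blast
  then have "card {R} \<le> nu (rects (P r))"
    by (intro card_le_nu[OF P_wf(1)]) (auto simp: disjoint_family_on_def)
  then show ?thesis by simp
qed

end

theory Submission
  imports Defs
begin

text \<open>
  Two bounds carry the theorem: \<open>\<nu>(P\<^sub>r) \<ge> q\<^sub>r\<close> and \<open>\<tau>(P\<^sub>r) \<le> 5/2 q\<^sub>r\<close>. Together with the general
  inequality \<open>\<alpha>\<^sup>* \<le> \<tau>\<close> (the rectangles assigned to one piercing point form a clique) they give
  both ratios.

  The lower bound holds because the \<open>q\<close> horizontal copies of a disjoint subfamily of \<open>D\<close> form a
  disjoint subfamily of the crossbar of \<open>D\<close>: copies at different markers lie in disjoint strips.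

  For the upper bound, only points of the marker grid are used, with multiplicities recorded in a
  table \<open>W\<close> of natural numbers (\<open>W j s\<close> is the multiplicity of the point where vertical marker \<open>j\<close>
  meets horizontal marker \<open>s\<close>). The crossbar of \<open>D\<close> consists of \<open>q\<close> horizontal and \<open>q\<close> vertical
  copies of \<open>D\<close>, and the horizontal copy \<open>i\<close> meets the vertical copy \<open>j\<close> in a block \<open>(i, j)\<close>. A point
  of this block acts on copy \<open>i\<close> as a point on vertical marker \<open>j\<close> of \<open>D\<close>, and on copy \<open>j\<close> as a point
  on vertical marker \<open>i\<close> of \<open>D\<close>. So if copy \<open>i\<close> is pierced by the table \<open>X\<^sub>i\<close> and copy \<open>j\<close> by \<open>Y\<^sub>j\<close>, and
  column \<open>j\<close> of \<open>X\<^sub>i\<close> has the same sum as column \<open>i\<close> of \<open>Y\<^sub>j\<close>, then one can pair up the points of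
  the two columns and serve both copies at the cost of one. The row sums of the
  tables \<open>Y\<^sub>j\<close> become the column sums of the new table, those of the \<open>X\<^sub>i\<close> its row sums.

  To keep this going one needs tables whose column sums are the same when seen from both copies.
  This is achieved by line sums in \<open>{2, 3}\<close> that follow a two-colouring and can be exchanged: there
  are colourings \<open>e\<close> of the columns and \<open>f\<close> of the rows such that, for all Booleans \<open>b\<close> and \<open>b'\<close>, some
  piercing table has column sums \<open>2 + [e j \<noteq> b]\<close> and row sums \<open>2 + [f s \<noteq> b']\<close>
  (\<open>switchable\<close>). In the crossbar, copy \<open>i\<close> uses \<open>b = e i\<close>, which puts the symmetric number
  \<open>2 + [e i \<noteq> e j]\<close> of points into block \<open>(i, j)\<close>, while \<open>b'\<close> remains free; hence the crossbar is
  switchable again. Finally the totals of the tables for \<open>b\<close> and for \<open>\<not> b\<close> add up to \<open>5 q\<close>, so one of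
  them has at most \<open>5/2 q\<close> points.
\<close>

section \<open>The clique relaxation is at most the piercing number\<close>

lemma alpha_star_le_tau:
  assumes fin: "finite F" and ne: "\<And>R. R \<in> F \<Longrightarrow> region R \<noteq> {}"
  shows "alpha_star F \<le> real (tau F)"
proof -
  obtain X where X: "finite X" "card X = tau F" "pierces X F"
    using tau_attained[OF assms] by blast
  define g where "g R = (SOME p. p \<in> X \<inter> region R)" for R
  have g: "g R \<in> X \<and> g R \<in> region R" if "R \<in> F" for R
  proof -
    have "\<exists>p. p \<in> X \<inter> region R" using X(3) that unfolding pierces_def by blast
    then have "g R \<in> X \<inter> region R" unfolding g_def by (rule someI_ex)
    then show ?thesis by blast
  qed
  obtain x where x: "clique_feasible F (intersection_edges F) x"
      "(\<Sum>v\<in>F. x v) = alpha_star F"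
    using graph_alpha_star_attained[OF fin] unfolding alpha_star_def by blast
  have "(\<Sum>v\<in>F. x v) = (\<Sum>p\<in>X. \<Sum>v\<in>{v\<in>F. g v = p}. x v)"
    using fin X(1) g by (intro sum.group[symmetric]) auto
  also have "\<dots> \<le> (\<Sum>p\<in>X. 1)"
  proof (rule sum_mono)
    fix p
    have "clique {v\<in>F. g v = p} (intersection_edges F)"
      unfolding clique_def
    proof (intro ballI impI)
      fix A B assume AB: "A \<in> {v\<in>F. g v = p}" "B \<in> {v\<in>F. g v = p}" "A \<noteq> B"
      then have "p \<in> region A \<inter> region B" using g[of A] g[of B] by simp
      then have "A \<in> F \<and> B \<in> F \<and> A \<noteq> B \<and> region A \<inter> region B \<noteq> {}"
        using AB by auto
      then show "{A, B} \<in> intersection_edges F" unfolding intersection_edges_def by blast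
    qed
    moreover have "{v\<in>F. g v = p} \<subseteq> F" by (rule Collect_restrict)
    moreover have "(\<Sum>v\<in>K. x v) \<le> 1" if "K \<subseteq> F" "clique K (intersection_edges F)" for K
      using x(1) that by (simp add: clique_feasible_def)
    ultimately show "(\<Sum>v\<in>{v\<in>F. g v = p}. x v) \<le> 1" by simp
  qed
  finally show ?thesis using x(2) X(2) by simp
qed

section \<open>Separated drawings and disjoint subfamilies\<close>

text \<open>The unit gaps are what keeps the copies of a family apart: they are stretched to gaps of
  \<open>side + 1\<close>, while a copy has thickness at most \<open>side\<close>.\<close>

definition separated :: "drawing \<Rightarrow> bool" where
  "separated D \<longleftrightarrow> 0 \<le> side D \<and>
     (\<forall>R\<in>rects D. region R \<noteq> {} \<and> region R \<subseteq> {0..side D} \<times> {0..side D}) \<and>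
     (\<forall>i<markers D. xi D i \<in> {0..side D} \<and> eta D i \<in> {0..side D}) \<and>
     (\<forall>i<markers D. \<forall>j<markers D. i \<noteq> j \<longrightarrow>
        1 \<le> \<bar>xi D i - xi D j\<bar> \<and> 1 \<le> \<bar>eta D i - eta D j\<bar>)"

lemma region_horizontal_copy:
  assumes "M > 0"
  shows "p \<in> region (horizontal_copy M c R) \<longleftrightarrow> (fst p / M, snd p - M * c) \<in> region R"
  using assms by (cases R; cases p) (auto simp: field_simps)

lemma region_vertical_copy:
  assumes "M > 0"
  shows "p \<in> region (vertical_copy M c R) \<longleftrightarrow> (snd p / M, fst p - M * c) \<in> region R"
  using assms by (cases R; cases p) (auto simp: field_simps)

lemma region_horizontal_copy_nonempty:
  assumes "M > 0" "region R \<noteq> {}"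
  shows "region (horizontal_copy M c R) \<noteq> {}"
  using assms by (cases R) auto

lemma region_vertical_copy_nonempty:
  assumes "M > 0" "region R \<noteq> {}"
  shows "region (vertical_copy M c R) \<noteq> {}"
  using assms by (cases R) auto

lemma crossbar_simps [simp]:
  "side (crossbar D) = (side D + 1) * side D + side D"
  "markers (crossbar D) = markers D * markers D"
  "xi (crossbar D) k = (side D + 1) * xi D (k div markers D) + eta D (k mod markers D)"
  "eta (crossbar D) k = (side D + 1) * xi D (k div markers D) + eta D (k mod markers D)"
  by (simp_all add: crossbar_def Let_def power2_eq_square)

lemma rects_crossbar:
  "rects (crossbar D) =
     {horizontal_copy (side D + 1) (xi D i) R | i R. i < markers D \<and> R \<in> rects D} \<union>
     {vertical_copy (side D + 1) (xi D j) R | j R. j < markers D \<and> R \<in> rects D}"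
  by (simp add: crossbar_def Let_def)

lemma div_mod_less_square:
  fixes k q :: nat
  assumes "k < q * q"
  shows "k div q < q" "k mod q < q"
proof -
  show "k div q < q" using assms by (simp add: less_mult_imp_div_less)
  have "0 < q" using assms by (cases q) auto
  then show "k mod q < q" by simp
qed

lemma pair_code_less_square:
  fixes i s q :: nat
  assumes "i < q" "s < q"
  shows "i * q + s < q * q"
proof -
  have "i * q + s < Suc i * q" using assms by simp
  also have "\<dots> \<le> q * q" using assms by (intro mult_right_mono) auto
  finally show ?thesis .
qed

lemma separated_crossbar:
  assumes "separated D"
  shows "separated (crossbar D)"
proof -
  define L q where "L = side D" and "q = markers D"
  have L: "0 \<le> L" and xe: "\<And>i. i < q \<Longrightarrow> xi D i \<in> {0..L} \<and> eta D i \<in> {0..L}"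
    and gap: "\<And>i j. i < q \<Longrightarrow> j < q \<Longrightarrow> i \<noteq> j \<Longrightarrow>
        1 \<le> \<bar>xi D i - xi D j\<bar> \<and> 1 \<le> \<bar>eta D i - eta D j\<bar>"
    and sub: "\<And>R. R \<in> rects D \<Longrightarrow> region R \<noteq> {} \<and> region R \<subseteq> {0..L} \<times> {0..L}"
    using assms by (auto simp: separated_def L_def q_def)
  have M: "0 < L + 1" using L by simp
  have strip: "(L + 1) * a + b \<in> {0..(L + 1) * L + L}" if "a \<in> {0..L}" "b \<in> {0..L}" for a b
    using that L by (auto intro!: add_mono mult_left_mono)
  have gap': "1 \<le> \<bar>((L + 1) * xi D (k div q) + eta D (k mod q)) -
                    ((L + 1) * xi D (l div q) + eta D (l mod q))\<bar>"
    if k: "k < q * q" and l: "l < q * q" and kl: "k \<noteq> l" for k l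
  proof (cases "k div q = l div q")
    case True
    then have "k mod q \<noteq> l mod q" using kl by (metis div_mult_mod_eq)
    then show ?thesis using True gap div_mod_less_square k l by simp
  next
    case False
    have "(L + 1) * 1 \<le> (L + 1) * \<bar>xi D (k div q) - xi D (l div q)\<bar>"
      using gap False div_mod_less_square k l M by (intro mult_left_mono) auto
    also have "\<dots> = \<bar>(L + 1) * xi D (k div q) - (L + 1) * xi D (l div q)\<bar>"
      using M by (simp add: abs_mult flip: right_diff_distrib)
    finally have "L + 1 \<le> \<bar>(L + 1) * xi D (k div q) - (L + 1) * xi D (l div q)\<bar>" by simp
    then show ?thesis using xe[OF div_mod_less_square(2)[OF k]] xe[OF div_mod_less_square(2)[OF l]]
      unfolding atLeastAtMost_iff by linarith
  qed
  have marker: "(L + 1) * xi D (k div q) + eta D (k mod q) \<in> {0..(L + 1) * L + L}"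
    if "k < q * q" for k
    using strip xe div_mod_less_square[OF that] by blast
  have rects: "region R \<noteq> {} \<and> region R \<subseteq> {0..(L + 1) * L + L} \<times> {0..(L + 1) * L + L}"
    if "R \<in> rects (crossbar D)" for R
  proof -
    have long: "z \<in> {0..(L + 1) * L + L}" if "z / (L + 1) \<in> {0..L}" for z
      using that M L by (auto simp: field_simps)
    have thin: "z \<in> {0..(L + 1) * L + L}" if "z - (L + 1) * a \<in> {0..L}" "a \<in> {0..L}" for z a
      using strip[OF that(2,1)] by simp
    consider i R' where "R = horizontal_copy (L + 1) (xi D i) R'" "i < q" "R' \<in> rects D"
      | j R' where "R = vertical_copy (L + 1) (xi D j) R'" "j < q" "R' \<in> rects D"
      using \<open>R \<in> rects (crossbar D)\<close> unfolding rects_crossbar L_def q_def by blast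
    then show ?thesis
    proof cases
      case 1
      have "region R \<noteq> {}"
        using region_horizontal_copy_nonempty[OF M] sub 1 by simp
      moreover have "p \<in> {0..(L + 1) * L + L} \<times> {0..(L + 1) * L + L}" if "p \<in> region R" for p
      proof -
        have "(fst p / (L + 1), snd p - (L + 1) * xi D i) \<in> {0..L} \<times> {0..L}"
          using that sub[OF 1(3)] unfolding 1(1) region_horizontal_copy[OF M] by blast
        then show ?thesis using long[of "fst p"] thin[of "snd p" "xi D i"] xe[OF 1(2)]
          unfolding mem_Times_iff fst_conv snd_conv by blast
      qed
      ultimately show ?thesis by blast
    next
      case 2
      have "region R \<noteq> {}"
        using region_vertical_copy_nonempty[OF M] sub 2 by simp
      moreover have "p \<in> {0..(L + 1) * L + L} \<times> {0..(L + 1) * L + L}" if "p \<in> region R" for p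
      proof -
        have "(snd p / (L + 1), fst p - (L + 1) * xi D j) \<in> {0..L} \<times> {0..L}"
          using that sub[OF 2(3)] unfolding 2(1) region_vertical_copy[OF M] by blast
        then show ?thesis using long[of "snd p"] thin[of "fst p" "xi D j"] xe[OF 2(2)]
          unfolding mem_Times_iff fst_conv snd_conv by blast
      qed
      ultimately show ?thesis by blast
    qed
  qed
  have "0 \<le> (L + 1) * L + L" using L by simp
  then show ?thesis
    unfolding separated_def crossbar_simps
    using rects marker gap' unfolding L_def q_def by blast
qed

lemma nu_crossbar:
  assumes sep: "separated D" and fin: "finite (rects D)" and fin': "finite (rects (crossbar D))"
  shows "markers D * nu (rects D) \<le> nu (rects (crossbar D))"
proof -
  define M q where "M = side D + 1" and "q = markers D"
  have M: "0 < M" using sep by (simp add: M_def separated_def)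
  have gap: "1 \<le> \<bar>xi D i - xi D j\<bar>" if "i < q" "j < q" "i \<noteq> j" for i j
    using sep that unfolding separated_def q_def by blast
  have sub: "region R \<noteq> {} \<and> region R \<subseteq> {0..side D} \<times> {0..side D}" if "R \<in> rects D" for R
    using sep that unfolding separated_def by blast
  obtain S where S: "S \<subseteq> rects D" "disjoint_family_on region S" "card S = nu (rects D)"
    using nu_attained[OF fin] by blast
  define h where "h = (\<lambda>(i, R). horizontal_copy M (xi D i) R)"
  define T where "T = h ` ({..<q} \<times> S)"
  have disj: "region (h z) \<inter> region (h w) = {}"
    if z: "z \<in> {..<q} \<times> S" and w: "w \<in> {..<q} \<times> S" and "z \<noteq> w" for z w
  proof -
    obtain i R j R' where zw: "z = (i, R)" "w = (j, R')" by fastforce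
    have ij: "i < q" "j < q" "R \<in> S" "R' \<in> S" "(i, R) \<noteq> (j, R')" using that zw by auto
    have False if p: "p \<in> region (h z)" "p \<in> region (h w)" for p
    proof -
      have R: "(fst p / M, snd p - M * xi D i) \<in> region R"
        and R': "(fst p / M, snd p - M * xi D j) \<in> region R'"
        using p region_horizontal_copy[OF M] by (auto simp: zw h_def)
      show False
      proof (cases "i = j")
        case True
        then have "R \<noteq> R'" using ij by blast
        then have "region R \<inter> region R' = {}"
          using S(2) ij unfolding disjoint_family_on_def by blast
        then show False using R R' True by blast
      next
        case False
        have "(fst p / M, snd p - M * xi D i) \<in> {0..side D} \<times> {0..side D}"
          "(fst p / M, snd p - M * xi D j) \<in> {0..side D} \<times> {0..side D}"
          using sub S(1) ij R R' by blast+
        then have "\<bar>M * xi D i - M * xi D j\<bar> < M" by (auto simp: M_def)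
        moreover have "M * 1 \<le> M * \<bar>xi D i - xi D j\<bar>"
          using gap[OF ij(1,2) False] M by (intro mult_left_mono) auto
        moreover have "M * \<bar>xi D i - xi D j\<bar> = \<bar>M * xi D i - M * xi D j\<bar>"
          using M by (simp add: abs_mult flip: right_diff_distrib)
        ultimately show False by linarith
      qed
    qed
    then show ?thesis by blast
  qed
  have "inj_on h ({..<q} \<times> S)"
  proof (rule inj_onI, rule ccontr)
    fix z w assume zw: "z \<in> {..<q} \<times> S" "w \<in> {..<q} \<times> S" "h z = h w" "z \<noteq> w"
    then have "region (h z) = {}" using disj[OF zw(1,2,4)] by simp
    moreover have "region (h z) \<noteq> {}"
      using zw(1) sub S(1) region_horizontal_copy_nonempty[OF M] by (force simp: h_def)
    ultimately show False by blast
  qed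
  then have "card T = q * card S" by (simp add: T_def card_image card_cartesian_product)
  moreover have "card T \<le> nu (rects (crossbar D))"
  proof (rule card_le_nu[OF fin'])
    show "T \<subseteq> rects (crossbar D)"
      using S(1) unfolding T_def h_def rects_crossbar M_def q_def by auto
    show "disjoint_family_on region T"
      unfolding disjoint_family_on_def T_def using disj by blast
  qed
  ultimately show ?thesis using S(3) by (simp add: q_def)
qed

lemma separated_base: "separated base_drawing"
proof -
  have all4: "(\<forall>j<4. p j) \<longleftrightarrow> p 0 \<and> p 1 \<and> p 2 \<and> p (3::nat)" for p
    by (auto simp: less_Suc_eq numeral_eq_Suc)
  show ?thesis
    unfolding separated_def by (auto simp: base_drawing_def all4)
qed

lemma separated_P: "separated (P r)"
  by (induction r) (simp_all add: separated_base separated_crossbar)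

lemma markers_le_nu: "markers (P r) \<le> nu (rects (P r))"
proof (induction r)
  case 0
  define S where "S = {Rect 0 30 26 28, Rect 0 16 20 22, Rect 0 8 2 10, Rect 14 24 8 14}"
  have "card S \<le> nu (rects (P 0))"
    by (rule card_le_nu[OF P_wf(1)])
      (auto simp: S_def base_drawing_def disjoint_family_on_def)
  then show ?case by (simp add: S_def base_drawing_def)
next
  case (Suc r)
  have "markers (P r) * markers (P r) \<le> markers (P r) * nu (rects (P r))"
    using Suc by simp
  also have "\<dots> \<le> nu (rects (P (Suc r)))"
    using nu_crossbar[OF separated_P P_wf(1)] P_wf(1)[of "Suc r"] by simp
  finally show ?case by simp
qed

section \<open>Piercing tables with switchable line sums\<close>

text \<open>Asking for the whole unit square at the marker point makes room for the next step: after
  stretching by \<open>side + 1\<close>, all markers of the next level that refine marker \<open>j\<close> still lie over the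
  rectangle.\<close>

definition unit_cell_inside :: "drawing \<Rightarrow> nat \<Rightarrow> nat \<Rightarrow> rect \<Rightarrow> bool" where
  "unit_cell_inside D j s R \<longleftrightarrow>
     (xi D j, eta D s) \<in> region R \<and> (xi D j + 1, eta D s + 1) \<in> region R"

definition piercing_table :: "drawing \<Rightarrow> (nat \<Rightarrow> nat \<Rightarrow> nat) \<Rightarrow> bool" where
  "piercing_table D W \<longleftrightarrow>
     (\<forall>R\<in>rects D. \<exists>j<markers D. \<exists>s<markers D. 0 < W j s \<and> unit_cell_inside D j s R)"

definition switchable :: "drawing \<Rightarrow> (nat \<Rightarrow> bool) \<Rightarrow> (nat \<Rightarrow> bool) \<Rightarrow> bool" where
  "switchable D e f \<longleftrightarrow> (\<forall>b b'. \<exists>W. piercing_table D W \<and>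
     (\<forall>j<markers D. (\<Sum>s<markers D. W j s) = 2 + of_bool (e j \<noteq> b)) \<and>
     (\<forall>s<markers D. (\<Sum>j<markers D. W j s) = 2 + of_bool (f s \<noteq> b')))"

lemma tau_le_table_total:
  assumes "piercing_table D W"
  shows "tau (rects D) \<le> (\<Sum>j<markers D. \<Sum>s<markers D. W j s)"
proof -
  define Z where "Z = {z \<in> {..<markers D} \<times> {..<markers D}. 0 < W (fst z) (snd z)}"
  define X where "X = (\<lambda>(j, s). (xi D j, eta D s)) ` Z"
  have Z: "finite Z" unfolding Z_def by simp
  have "pierces X (rects D)"
    unfolding pierces_def
  proof
    fix R assume "R \<in> rects D"
    then obtain j s where "j < markers D" "s < markers D" "0 < W j s" "unit_cell_inside D j s R"
      using assms unfolding piercing_table_def by blast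
    then have "(xi D j, eta D s) \<in> X" "(xi D j, eta D s) \<in> region R"
      by (auto simp: X_def Z_def unit_cell_inside_def image_iff)
    then show "X \<inter> region R \<noteq> {}" by blast
  qed
  then have "tau (rects D) \<le> card X" using Z by (intro tau_le_card) (auto simp: X_def)
  also have "\<dots> \<le> card Z" unfolding X_def by (rule card_image_le[OF Z])
  also have "\<dots> = (\<Sum>z\<in>Z. 1)" by simp
  also have "\<dots> \<le> (\<Sum>z\<in>Z. W (fst z) (snd z))" by (rule sum_mono) (auto simp: Z_def)
  also have "\<dots> \<le> (\<Sum>z\<in>{..<markers D} \<times> {..<markers D}. W (fst z) (snd z))"
    by (rule sum_mono2) (auto simp: Z_def)
  also have "\<dots> = (\<Sum>j<markers D. \<Sum>s<markers D. W j s)"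
    by (simp add: sum.cartesian_product case_prod_beta)
  finally show ?thesis .
qed

text \<open>Switching \<open>b\<close> turns every column sum \<open>2\<close> into \<open>3\<close> and vice versa, so the average of the two
  totals is \<open>5/2\<close> per column, whatever the colouring.\<close>

lemma tau_le_of_switchable:
  assumes "switchable D e f"
  shows "2 * tau (rects D) \<le> 5 * markers D"
proof -
  have bound: "tau (rects D) \<le> (\<Sum>j<markers D. 2 + of_bool (e j \<noteq> b))" for b
  proof -
    obtain W where "piercing_table D W"
      "\<forall>j<markers D. (\<Sum>s<markers D. W j s) = 2 + of_bool (e j \<noteq> b)"
      using assms unfolding switchable_def by blast
    then show ?thesis using tau_le_table_total[of D W] by simp
  qed
  have "2 * tau (rects D) \<le>
      (\<Sum>j<markers D. 2 + of_bool (e j \<noteq> True)) + (\<Sum>j<markers D. 2 + of_bool (e j \<noteq> False))"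
    using bound[of True] bound[of False] by linarith
  also have "\<dots> = (\<Sum>j<markers D. 5)"
    unfolding sum.distrib[symmetric] by (rule sum.cong) auto
  finally show ?thesis by simp
qed

text \<open>Contingency tables with prescribed margins exist: this is how the points of two columns with
  the same sum are paired up.\<close>

lemma ex_table_with_margins:
  fixes a :: "'a \<Rightarrow> nat" and b :: "'b \<Rightarrow> nat"
  assumes "finite A" "finite B" "sum a A = sum b B"
  shows "\<exists>m. (\<forall>t\<in>A. (\<Sum>s\<in>B. m t s) = a t) \<and> (\<forall>s\<in>B. (\<Sum>t\<in>A. m t s) = b s)"
  using assms(3)
proof (induction "sum a A" arbitrary: a b)
  case 0
  then show ?case using assms(1,2) by (intro exI[of _ "\<lambda>_ _. 0"]) auto
next
  case (Suc n)
  obtain t0 where t0: "t0 \<in> A" "a t0 > 0"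
    using Suc(2) by (metis gr0I sum.neutral nat.distinct(1))
  obtain s0 where s0: "s0 \<in> B" "b s0 > 0"
    using Suc(2,3) by (metis gr0I sum.neutral nat.distinct(1))
  define a' b' where "a' t = a t - of_bool (t = t0)" and "b' s = b s - of_bool (s = s0)" for t s
  have a: "a t = a' t + of_bool (t = t0)" and b: "b s = b' s + of_bool (s = s0)" for t s
    using t0 s0 by (auto simp: a'_def b'_def)
  have sums: "sum a A = Suc (sum a' A)" "sum b B = Suc (sum b' B)"
    using t0 s0 assms(1,2) by (simp_all add: sum.remove[of A t0] sum.remove[of B s0] a'_def b'_def)
  have "n = sum a' A" "sum a' A = sum b' B" using sums Suc(2,3) by simp_all
  from Suc(1)[OF this]
  obtain m where m: "\<forall>t\<in>A. (\<Sum>s\<in>B. m t s) = a' t" "\<forall>s\<in>B. (\<Sum>t\<in>A. m t s) = b' s"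
    by blast
  have "(\<Sum>s\<in>B. m t s + of_bool (t = t0 \<and> s = s0)) = a t" if "t \<in> A" for t
  proof -
    have "(\<Sum>s\<in>B. of_bool (t = t0 \<and> s = s0)) = (of_bool (t = t0) :: nat)"
      using s0(1) assms(2) by (cases "t = t0") (simp_all add: of_bool_def)
    then show ?thesis using m(1) that by (simp only: sum.distrib a)
  qed
  moreover have "(\<Sum>t\<in>A. m t s + of_bool (t = t0 \<and> s = s0)) = b s" if "s \<in> B" for s
  proof -
    have "(\<Sum>t\<in>A. of_bool (t = t0 \<and> s = s0)) = (of_bool (s = s0) :: nat)"
      using t0(1) assms(1) by (cases "s = s0") (simp_all add: of_bool_def)
    then show ?thesis using m(2) that by (simp only: sum.distrib b)
  qed
  ultimately show ?case by (intro exI[of _ "\<lambda>t s. m t s + of_bool (t = t0 \<and> s = s0)"]) blast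
qed

lemma sum_div_mod:
  fixes g :: "nat \<Rightarrow> nat \<Rightarrow> 'a::comm_monoid_add"
  shows "(\<Sum>k<q * q. g (k div q) (k mod q)) = (\<Sum>i<q. \<Sum>s<q. g i s)"
proof -
  have "(\<Sum>k<q * q. g (k div q) (k mod q)) = (\<Sum>(i, s)\<in>{..<q} \<times> {..<q}. g i s)"
    by (rule sum.reindex_bij_witness[of _ "\<lambda>(i, s). i * q + s" "\<lambda>k. (k div q, k mod q)"])
      (auto simp: div_mod_less_square pair_code_less_square)
  then show ?thesis by (simp add: sum.cartesian_product)
qed

lemma unit_cell_inside_horizontal_copy:
  assumes "separated D" "i < markers D" "j < markers D" "s < markers D" "t < markers D"
    and "unit_cell_inside D j s R"
  shows "unit_cell_inside (crossbar D) (j * markers D + t) (i * markers D + s)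
           (horizontal_copy (side D + 1) (xi D i) R)"
proof -
  obtain x1 x2 y1 y2 where R: "R = Rect x1 x2 y1 y2" by (cases R)
  have t: "0 \<le> eta D t" "eta D t \<le> side D" and L: "0 \<le> side D"
    using assms by (auto simp: separated_def)
  have x: "x1 \<le> xi D j" "xi D j + 1 \<le> x2" and y: "y1 \<le> eta D s" "eta D s + 1 \<le> y2"
    using assms by (auto simp: unit_cell_inside_def R)
  have "(side D + 1) * x1 \<le> (side D + 1) * xi D j" "(side D + 1) * (xi D j + 1) \<le> (side D + 1) * x2"
    using x L by (auto intro!: mult_left_mono)
  then have "(side D + 1) * x1 \<le> (side D + 1) * xi D j + eta D t"
    "(side D + 1) * x1 \<le> (side D + 1) * xi D j + eta D t + 1"
    "(side D + 1) * xi D j + eta D t \<le> (side D + 1) * x2"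
    "(side D + 1) * xi D j + eta D t + 1 \<le> (side D + 1) * x2"
    using t unfolding distrib_left[of _ "xi D j" 1] mult_1_right by linarith+
  then show ?thesis
    using y assms(4,5) by (simp add: unit_cell_inside_def R)
qed

lemma unit_cell_inside_vertical_copy:
  assumes "separated D" "i < markers D" "j < markers D" "s < markers D" "t < markers D"
    and "unit_cell_inside D i t R"
  shows "unit_cell_inside (crossbar D) (j * markers D + t) (i * markers D + s)
           (vertical_copy (side D + 1) (xi D j) R)"
proof -
  have "vertical_copy M c R = (case horizontal_copy M c R of Rect x1 x2 y1 y2 \<Rightarrow> Rect y1 y2 x1 x2)"
    for M c by (cases R) simp
  moreover have "unit_cell_inside (crossbar D) (i * markers D + s) (j * markers D + t)
      (horizontal_copy (side D + 1) (xi D j) R)"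
    using assms by (intro unit_cell_inside_horizontal_copy) auto
  ultimately show ?thesis
    by (cases "horizontal_copy (side D + 1) (xi D j) R") (auto simp: unit_cell_inside_def)
qed

text \<open>The heart of the proof. Copy \<open>i\<close> switches its columns by its own colour \<open>e i\<close>, so that the
  demand \<open>2 + [e i \<noteq> e j]\<close> on block \<open>(i, j)\<close> is symmetric in the two copies that share the block. The
  row sums of the tables survive as the line sums of the crossbar, which therefore inherits the
  row colouring \<open>f\<close> on the second component of its markers, in both directions.\<close>

lemma switchable_crossbar:
  assumes sep: "separated D" and sw: "switchable D e f"
  shows "switchable (crossbar D) (\<lambda>k. f (k mod markers D)) (\<lambda>k. f (k mod markers D))"
  unfolding switchable_def
proof (intro allI)
  fix c c' :: bool
  define q where "q = markers D"
  obtain W where W: "\<And>b b'. piercing_table D (W b b')"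
      and col: "\<And>b b' j. j < q \<Longrightarrow> (\<Sum>s<q. W b b' j s) = 2 + of_bool (e j \<noteq> b)"
      and row: "\<And>b b' s. s < q \<Longrightarrow> (\<Sum>j<q. W b b' j s) = 2 + of_bool (f s \<noteq> b')"
    using sw unfolding switchable_def q_def by metis
  define X Y where "X i = W (e i) c'" and "Y j = W (e j) c" for i j
  have "\<exists>m. (\<forall>t\<in>{..<q}. (\<Sum>s<q. m t s) = Y j i t) \<and> (\<forall>s\<in>{..<q}. (\<Sum>t<q. m t s) = X i j s)"
    if "i < q" "j < q" for i j
    using that by (intro ex_table_with_margins) (auto simp: X_def Y_def col)
  then obtain m where mY: "\<And>i j t. i < q \<Longrightarrow> j < q \<Longrightarrow> t < q \<Longrightarrow> (\<Sum>s<q. m i j t s) = Y j i t"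
      and mX: "\<And>i j s. i < q \<Longrightarrow> j < q \<Longrightarrow> s < q \<Longrightarrow> (\<Sum>t<q. m i j t s) = X i j s"
    unfolding Ball_def lessThan_iff by metis
  define V where "V k l = m (l div q) (k div q) (k mod q) (l mod q)" for k l
  have "piercing_table (crossbar D) V"
    unfolding piercing_table_def crossbar_simps q_def[symmetric]
  proof
    fix R assume "R \<in> rects (crossbar D)"
    then consider i R' where "R = horizontal_copy (side D + 1) (xi D i) R'" "i < q" "R' \<in> rects D"
      | j R' where "R = vertical_copy (side D + 1) (xi D j) R'" "j < q" "R' \<in> rects D"
      unfolding rects_crossbar q_def by blast
    then have "\<exists>i<q. \<exists>j<q. \<exists>s<q. \<exists>t<q. 0 < m i j t s \<and>
        unit_cell_inside (crossbar D) (j * q + t) (i * q + s) R"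
    proof cases
      case 1
      obtain j s where js: "j < q" "s < q" "0 < X i j s" "unit_cell_inside D j s R'"
        using W 1(3) unfolding X_def piercing_table_def q_def by meson
      then have "(\<Sum>t<q. m i j t s) \<noteq> 0" using mX 1(2) by simp
      then obtain t where t: "t < q" "0 < m i j t s" by auto
      then show ?thesis
        using unit_cell_inside_horizontal_copy[OF sep] js 1 unfolding q_def by blast
    next
      case 2
      obtain i t where it: "i < q" "t < q" "0 < Y j i t" "unit_cell_inside D i t R'"
        using W 2(3) unfolding Y_def piercing_table_def q_def by meson
      then have "(\<Sum>s<q. m i j t s) \<noteq> 0" using mY 2(2) by simp
      then obtain s where s: "s < q" "0 < m i j t s" by auto
      then show ?thesis
        using unit_cell_inside_vertical_copy[OF sep] it 2 unfolding q_def by blast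
    qed
    then obtain i j s t where *: "i < q" "j < q" "s < q" "t < q" "0 < m i j t s"
        "unit_cell_inside (crossbar D) (j * q + t) (i * q + s) R" by blast
    then have "0 < V (j * q + t) (i * q + s)" by (simp add: V_def)
    then show "\<exists>k<q * q. \<exists>l<q * q. 0 < V k l \<and> unit_cell_inside (crossbar D) k l R"
      using * pair_code_less_square by blast
  qed
  moreover have "(\<Sum>l<q * q. V k l) = 2 + of_bool (f (k mod q) \<noteq> c)" if k: "k < q * q" for k
  proof -
    have "(\<Sum>l<q * q. V k l) = (\<Sum>i<q. \<Sum>s<q. m i (k div q) (k mod q) s)"
      unfolding V_def by (rule sum_div_mod)
    also have "\<dots> = (\<Sum>i<q. Y (k div q) i (k mod q))"
      using div_mod_less_square[OF k] by (simp add: mY)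
    also have "\<dots> = 2 + of_bool (f (k mod q) \<noteq> c)"
      using div_mod_less_square[OF k] by (simp add: Y_def row)
    finally show ?thesis .
  qed
  moreover have "(\<Sum>k<q * q. V k l) = 2 + of_bool (f (l mod q) \<noteq> c')" if l: "l < q * q" for l
  proof -
    have "(\<Sum>k<q * q. V k l) = (\<Sum>j<q. \<Sum>t<q. m (l div q) j t (l mod q))"
      unfolding V_def by (rule sum_div_mod)
    also have "\<dots> = (\<Sum>j<q. X (l div q) j (l mod q))"
      using div_mod_less_square[OF l] by (simp add: mX)
    also have "\<dots> = 2 + of_bool (f (l mod q) \<noteq> c')"
      using div_mod_less_square[OF l] by (simp add: X_def row)
    finally show ?thesis .
  qed
  ultimately show "\<exists>V. piercing_table (crossbar D) V \<and>
     (\<forall>j<markers (crossbar D). (\<Sum>s<markers (crossbar D). V j s) =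
        2 + of_bool (f (j mod markers D) \<noteq> c)) \<and>
     (\<forall>s<markers (crossbar D). (\<Sum>j<markers (crossbar D). V j s) =
        2 + of_bool (f (s mod markers D) \<noteq> c'))"
    unfolding crossbar_simps q_def by blast
qed

text \<open>The eight base rectangles can be pierced by eight grid points, two on each vertical marker.
  On the horizontal markers these points are distributed as \<open>(3, 2, 2, 1)\<close> or as \<open>(2, 3, 2, 1)\<close>,
  because \<open>C\<^sub>3\<close> meets both of the lowest two markers; this freedom is what makes the row sums
  switchable. Two surplus points, in the columns selected by \<open>b\<close>, fill up the sums.\<close>

lemma switchable_base:
  "switchable base_drawing (\<lambda>j. j \<in> {0, 1}) (\<lambda>s. s \<in> {0, 3})"
  unfolding switchable_def
proof (intro allI)
  fix b b' :: bool
  \<comment> \<open>Outer index: column. The rectangles pierced are \<open>C\<^sub>0\<close>, \<open>U\<^sub>L\<close>; then \<open>Q\<close>, \<open>C\<^sub>1\<close>; then \<open>C\<^sub>2\<close>, \<open>U\<^sub>R\<close>;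
    then \<open>C\<^sub>3\<close>, \<open>T\<close>.\<close>
  define N :: "nat list list" where
    "N = [[1, 0, 1, 0], [1, 1, 0, 0], [0, 1, 1, 0], [of_bool (\<not> b'), of_bool b', 0, 1]]"
  define W where "W j s = N ! j ! s
      + of_bool (j = (if b then 2 else 0) \<and> s = (if b' then 2 else 3))
      + of_bool (j = (if b then 3 else 1) \<and> s = 3)" for j s
  have less4: "{..<4} = {0, 1, 2, 3::nat}" by auto
  have all4: "(\<forall>j<4. p j) \<longleftrightarrow> p 0 \<and> p 1 \<and> p 2 \<and> p (3::nat)" for p
    by (auto simp: less_Suc_eq numeral_eq_Suc)
  have ex4: "(\<exists>j<4. p j) \<longleftrightarrow> p 0 \<or> p 1 \<or> p 2 \<or> p (3::nat)" for p
    by (auto simp: less_Suc_eq numeral_eq_Suc)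
  have "piercing_table base_drawing W"
    unfolding piercing_table_def unit_cell_inside_def
    by (cases b'; simp add: base_drawing_def ex4 W_def N_def)
  moreover have "\<forall>j<4. (\<Sum>s<4. W j s) = 2 + of_bool ((j \<in> {0, 1}) \<noteq> b)"
    unfolding all4 less4 by (cases b; cases b'; simp add: W_def N_def)
  moreover have "\<forall>s<4. (\<Sum>j<4. W j s) = 2 + of_bool ((s \<in> {0, 3}) \<noteq> b')"
    unfolding all4 less4 by (cases b; cases b'; simp add: W_def N_def)
  ultimately show "\<exists>W. piercing_table base_drawing W \<and>
     (\<forall>j<markers base_drawing. (\<Sum>s<markers base_drawing. W j s) =
        2 + of_bool ((j \<in> {0, 1}) \<noteq> b)) \<and>
     (\<forall>s<markers base_drawing. (\<Sum>j<markers base_drawing. W j s) =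
        2 + of_bool ((s \<in> {0, 3}) \<noteq> b'))"
    by (intro exI[of _ W]) (simp add: base_drawing_def)
qed

lemma switchable_P: "\<exists>e f. switchable (P r) e f"
proof (induction r)
  case 0
  show ?case using switchable_base by auto
next
  case (Suc r)
  then show ?case using switchable_crossbar[OF separated_P] by fastforce
qed

section \<open>The bounds for the families\<close>

lemma markers_P: "markers (P r) = 4 ^ (2 ^ r)"
  by (induction r) (simp_all add: base_drawing_def power_add mult_2)

theorem proposition22:
  fixes r :: nat
  shows "markers (P r) = 4 ^ (2 ^ r) \<and>
         real (tau (rects (P r))) \<le> 5 / 2 * real (markers (P r)) \<and>
         real (tau (rects (P r))) / real (nu (rects (P r))) \<le> 5 / 2 \<and>
         alpha_star (rects (P r)) / real (nu (rects (P r))) \<le> 5 / 2"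
proof -
  obtain e f where "switchable (P r) e f" using switchable_P by blast
  then have "real (2 * tau (rects (P r))) \<le> real (5 * markers (P r))"
    by (intro of_nat_mono tau_le_of_switchable)
  then have tau: "real (tau (rects (P r))) \<le> 5 / 2 * real (markers (P r))" by simp
  also have "\<dots> \<le> 5 / 2 * real (nu (rects (P r)))" using markers_le_nu by simp
  finally have tau_nu: "real (tau (rects (P r))) \<le> 5 / 2 * real (nu (rects (P r)))" .
  have "alpha_star (rects (P r)) \<le> 5 / 2 * real (nu (rects (P r)))"
    using alpha_star_le_tau[OF P_wf(1) P_wf(3)] tau_nu by (rule order_trans)
  then show ?thesis
    using markers_P tau tau_nu nu_P_pos[of r] by (simp add: divide_le_eq)
qed

end
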